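(* The proportion of number-conserving rules among all CA rules with two inputs and $q$ states tends to zero as the number of states $q$ increases, that is, $$\lim_{q\to\infty}\frac{\Lambda_{2,q}}{q^{q^2}}=0,$$ where $q$ ranges over the positive integers and $\Lambda_{2,q}$ is the number of number-conserving CA rules with two inputs and $q$ states.
   Context: For a positive integer $q$, let $\mathcal{Q}=\{0,1,\ldots,q-1\}$. A CA (cellular automaton) rule with two inputs and $q$ states is a function $f:\mathcal{Q}^2\to\mathcal{Q}$; there are $q^{q^2}$ of them. The rule $f$ is number-conserving if for every integer $L\ge 2$ and every cyclic configuration $(x_1,x_2,\ldots,x_L)\in\mathcal{Q}^L$, $$f(x_1,x_2)+f(x_2,x_3)+\cdots+f(x_{L-1},x_L)+f(x_L,x_1)=x_1+x_2+\cdots+x_L,$$ where sums are ordinary sums of integers. $\Lambda_{2,q}$ denotes the number of functions $f:\mathcal{Q}^2\to\mathcal{Q}$ that are number-conserving. *)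

theory Defs
  imports Complex_Main "HOL-Library.FuncSet"
begin

definition states :: "nat \<Rightarrow> nat set" where
  "states q = {0..<q}"

text \<open>Rules are extensional, so that each map on pairs of states is counted exactly once.\<close>

definition ca_rules :: "nat \<Rightarrow> (nat \<times> nat \<Rightarrow> nat) set" where
  "ca_rules q = (states q \<times> states q) \<rightarrow>\<^sub>E states q"

text \<open>Cyclic configurations of length \<open>L\<close> are indexed by \<open>0, \<dots>, L - 1\<close>, with indices read
  modulo \<open>L\<close>.\<close>

definition number_conserving :: "nat \<Rightarrow> (nat \<times> nat \<Rightarrow> nat) \<Rightarrow> bool" where
  "number_conserving q f \<longleftrightarrow>
     (\<forall>L::nat\<ge>2. \<forall>x \<in> {0..<L} \<rightarrow> states q.
        (\<Sum>i = 0..<L. f (x i, x ((i + 1) mod L))) = (\<Sum>i = 0..<L. x i))"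

definition Lambda2 :: "nat \<Rightarrow> nat" where
  "Lambda2 q = card {f \<in> ca_rules q. number_conserving q f}"

lemma finite_ca_rules: "finite (ca_rules q)"
  by (simp add: ca_rules_def states_def finite_PiE)

lemma card_ca_rules: "card (ca_rules q) = q ^ (q\<^sup>2)"
  by (simp add: ca_rules_def states_def card_PiE card_cartesian_product power2_eq_square)

end

(* A number-conserving rule must fix (0,0) \<mapsto> 0, and overwriting this single forced value with
   an arbitrary state turns each such rule into q distinct rules; so the proportion is at most 1/q. *)
theory Submission
  imports Defs
begin

text \<open>On the all-zero configuration of length 2, conservation reads
  \<open>f (0, 0) + f (0, 0) = 0\<close>.\<close>

lemma number_conserving_quiescent:
  assumes "number_conserving q f" and "q > 0"
  shows "f (0, 0) = 0"
proof -
  have "(\<lambda>_. 0) \<in> {0..<2::nat} \<rightarrow> states q"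
    using assms(2) by (auto simp: states_def)
  with assms(1)[unfolded number_conserving_def, rule_format, of 2 "\<lambda>_. 0"]
  show ?thesis by simp
qed

lemma Lambda2_times_states_le:
  assumes "q > 0"
  shows "Lambda2 q * q \<le> q ^ (q\<^sup>2)"
proof -
  let ?S = "{f \<in> ca_rules q. number_conserving q f}"
  let ?h = "\<lambda>(f :: nat \<times> nat \<Rightarrow> nat, c). f((0, 0) := c)"
  have "inj_on ?h (?S \<times> states q)"
  proof (rule inj_onI, clarify)
    fix f c g d
    assume fg: "number_conserving q f" "number_conserving q g"
      and eq: "f((0, 0) := c) = g((0, 0) := d)"
    have "f (0, 0) = 0" "g (0, 0) = 0"
      using fg assms by (auto intro: number_conserving_quiescent)
    \<comment> \<open>Since the overwritten value was 0, writing 0 back recovers the original rule,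
      so the modified rule determines \<open>f\<close>; its value at \<open>(0, 0)\<close> is
      \<open>c\<close>.\<close>
    then have "f = (f((0, 0) := c))((0, 0) := 0)" "(g((0, 0) := d))((0, 0) := 0) = g"
      by (simp_all add: fun_upd_idem)
    then have "f = g" unfolding eq by (rule trans)
    moreover have "c = d" using fun_cong[OF eq, of "(0, 0)"] by simp
    ultimately show "f = g \<and> c = d" by blast
  qed
  moreover have "f((0, 0) := c) \<in> ca_rules q" if "f \<in> ca_rules q" "c \<in> states q" for f c
  proof -
    \<comment> \<open>\<open>PiE_fun_upd\<close> adds the updated point to the domain; for
      \<open>q > 0\<close> that point already lies there.\<close>
    have "insert (0, 0) (states q \<times> states q) = states q \<times> states q"
      using assms by (auto simp: states_def)
    with that show ?thesis
      unfolding ca_rules_def by (metis PiE_fun_upd)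
  qed
  then have "?h ` (?S \<times> states q) \<subseteq> ca_rules q"
    by auto
  ultimately have "card (?S \<times> states q) \<le> card (ca_rules q)"
    by (rule card_inj_on_le) (rule finite_ca_rules)
  then show ?thesis
    by (simp add: card_cartesian_product card_ca_rules Lambda2_def states_def)
qed

theorem corollary1:
  shows "(\<lambda>q::nat. real (Lambda2 q) / real q ^ (q\<^sup>2)) \<longlonglongrightarrow> 0"
proof (rule tendsto_sandwich)
  show "\<forall>\<^sub>F q in sequentially. 0 \<le> real (Lambda2 q) / real q ^ (q\<^sup>2)"
    by simp
  show "\<forall>\<^sub>F q in sequentially. real (Lambda2 q) / real q ^ (q\<^sup>2) \<le> 1 / real q"
    \<comment> \<open>The bound fails at \<open>q = 0\<close>: the single empty rule conserves
      vacuously, so the left side is 1, while \<open>1 / 0 = 0\<close>.\<close>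
    using eventually_gt_at_top[of 0]
  proof eventually_elim
    case (elim q)
    have "real (Lambda2 q) * real q \<le> real q ^ (q\<^sup>2)"
      using Lambda2_times_states_le[OF elim]
      by (simp flip: of_nat_mult of_nat_power)
    with elim show ?case by (simp add: field_simps)
  qed
qed (rule tendsto_const lim_1_over_n)+

end
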